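(* The Wright function $$W_{\alpha,\beta}(z) = \sum_{k=0}^{\infty} \frac{z^k}{k!\, \Gamma(\alpha k + \beta)},\qquad z\in\mathbb{C},$$ is differentiable with respect to each of the complex parameters $\alpha,\beta$ for all $\alpha\in\mathbb{C}$ with $\mathrm{Re}\,\alpha>-1$ and all $\beta\in\mathbb{C}$, and for all such $\alpha,\beta$ and all $z\in\mathbb{C}$ $$\frac{\partial W_{\alpha,\beta}(z)}{\partial \alpha} = - \sum_{k=1}^{\infty} \frac{k\, \psi(\alpha k + \beta)}{k!\, \Gamma(\alpha k + \beta)}\, z^k,\qquad \frac{\partial W_{\alpha,\beta}(z)}{\partial \beta} = - \sum_{k=0}^{\infty} \frac{\psi(\alpha k + \beta)}{k!\, \Gamma(\alpha k + \beta)}\, z^k .$$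
   Context: $1/\Gamma$ is understood as an entire function (equal to $0$ at $0,-1,-2,\dots$). $\psi=\Gamma'/\Gamma$ is the digamma function. The ratio $\psi(w)/\Gamma(w)$ is understood as an entire function of $w$, namely $\psi(w)/\Gamma(w)=-(1/\Gamma)'(w)$, its removable singularities at $w=0,-1,-2,\dots$ being filled in by continuity. *)

theory Defs
  imports "HOL-Complex_Analysis.Complex_Analysis"
begin

(* rGamma is the library's entire function 1/Gamma, with value 0 at 0, -1, -2, ... *)
definition Wright :: "complex \<Rightarrow> complex \<Rightarrow> complex \<Rightarrow> complex" where
  "Wright \<alpha> \<beta> z = (\<Sum>k. z ^ k / fact k * rGamma (\<alpha> * of_nat k + \<beta>))"

(* remove_sings fills the removable singularities at 0, -1, -2, ... by continuity; there both
   Digamma and Gamma only have placeholder values. *)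
definition Digamma_over_Gamma :: "complex \<Rightarrow> complex" where
  "Digamma_over_Gamma = remove_sings (\<lambda>w. Digamma w / Gamma w)"

lemma Digamma_over_Gamma_eq_deriv_rGamma: "Digamma_over_Gamma w = - deriv rGamma w"
proof -
  have "deriv rGamma holomorphic_on (UNIV :: complex set)"
    by (intro holomorphic_deriv holomorphic_rGamma) auto
  hence cont: "(deriv rGamma \<longlongrightarrow> deriv rGamma w) (at w)"
    by (metis UNIV_I continuous_on_def holomorphic_on_imp_continuous_on)
  have "\<forall>\<^sub>F u in at w. u \<notin> \<int>\<^sub>\<le>\<^sub>0"
  proof -
    have "\<forall>\<^sub>F u in at w. u \<in> - (\<int>\<^sub>\<le>\<^sub>0 - {w})"
      by (intro eventually_at_in_open' open_Compl closed_subset_Ints) (auto elim!: nonpos_Ints_cases)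
    thus ?thesis
      using eventually_neq_at_within[of w w UNIV] by eventually_elim auto
  qed
  hence ev: "\<forall>\<^sub>F u in at w. - deriv rGamma u = Digamma u / Gamma u"
  proof eventually_elim
    case (elim u)
    have "deriv rGamma u = - rGamma u * Digamma u"
      using elim by (intro DERIV_imp_deriv has_field_derivative_rGamma_no_nonpos_int)
    thus ?case by (simp add: rGamma_inverse_Gamma field_simps)
  qed
  have "((\<lambda>u. Digamma u / Gamma u) \<longlongrightarrow> - deriv rGamma w) (at w)"
    using tendsto_minus[OF cont] ev by (rule Lim_transform_eventually)
  thus ?thesis
    unfolding Digamma_over_Gamma_def by (rule remove_sings_eqI)
qed

lemma Digamma_over_Gamma_eq:
  assumes "w \<notin> \<int>\<^sub>\<le>\<^sub>0"
  shows "Digamma_over_Gamma w = Digamma w / Gamma w"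
proof -
  have "deriv rGamma w = - rGamma w * Digamma w"
    using assms by (intro DERIV_imp_deriv has_field_derivative_rGamma_no_nonpos_int)
  thus ?thesis
    by (simp add: Digamma_over_Gamma_eq_deriv_rGamma rGamma_inverse_Gamma field_simps)
qed

end

theory Submission
  imports Defs "HOL-Real_Asymp.Real_Asymp"
begin

text \<open>
  The Wright series is differentiated term by term, which is legitimate for a locally uniformly
  convergent series of holomorphic functions. Local uniformity comes from a growth bound on
  \<open>rGamma\<close>: in a left half-plane, the reflection formula together with
  \<open>\<bar>Gamma z\<bar> \<le> Gamma (Re z)\<close> gives \<open>\<bar>rGamma w\<bar> \<le> C * Gamma (2 - Re w) * exp (pi * \<bar>Im w\<bar>)\<close>,
  and to the right \<open>\<bar>rGamma w\<bar> \<le> C * exp (pi * \<bar>Im w\<bar>)\<close> follows from the functional equation.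
  If \<open>Re a \<ge> - s\<close> with \<open>0 < s < 1\<close>, the terms are thus dominated by
  \<open>A ^ k / fact k * Gamma (s * k + c)\<close>, which is summable by the ratio test, since log-convexity
  gives \<open>Gamma (x + s) \<le> x powr s * Gamma x\<close> and \<open>s < 1\<close>.
\<close>

section \<open>Inequalities for the Gamma function\<close>

lemma norm_Gamma_complex_le:
  assumes "Re z > 0"
  shows "norm (Gamma z) \<le> Gamma (Re z)"
proof (rule tendsto_le[OF _ Gamma_series_LIMSEQ tendsto_norm[OF Gamma_series_LIMSEQ]])
  \<comment> \<open>In Euler's limit formula the numerator has the same modulus for \<open>z\<close>
    and \<open>Re z\<close>, while each factor of the denominator only grows:
    \<open>norm (z + i)\<close> \<ge> \<open>Re z + i\<close> > 0.\<close>
  have "norm (Gamma_series z n) \<le> Gamma_series (Re z) n" if "n > 0" for n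
  proof -
    have "(\<Prod>i<n+1. Re z + of_nat i) \<le> (\<Prod>i<n+1. norm (z + of_nat i))"
    proof (intro prod_mono conjI)
      fix i assume "i \<in> {..<n+1}"
      show "0 \<le> Re z + real i" using assms by simp
      show "Re z + of_nat i \<le> norm (z + of_nat i)"
        using complex_Re_le_cmod[of "z + of_nat i"] by simp
    qed
    hence "pochhammer (Re z) (n+1) \<le> norm (pochhammer z (n+1))"
      unfolding pochhammer_prod prod_norm lessThan_atLeast0 .
    moreover have "0 < pochhammer (Re z) (n+1)"
      using assms by (intro pochhammer_pos)
    ultimately show ?thesis
      using that unfolding Gamma_series_def norm_divide norm_mult norm_fact
      by (simp del: pochhammer_Suc add: frac_le)
  qed
  thus "\<forall>\<^sub>F n in sequentially. norm (Gamma_series z n) \<le> Gamma_series (Re z) n"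
    by (rule eventually_mono[OF eventually_gt_at_top])
qed auto

text \<open>Convexity of \<open>ln \<circ> Gamma\<close> between \<open>x\<close> and
  \<open>x + 1\<close>, where the right end value is \<open>ln x + ln (Gamma x)\<close>.\<close>

lemma Gamma_add_le_powr_mult:
  fixes x s :: real
  assumes "x > 0" "0 \<le> s" "s \<le> 1"
  shows "Gamma (x + s) \<le> x powr s * Gamma x"
proof -
  have "(ln \<circ> Gamma) ((1 - s) *\<^sub>R x + s *\<^sub>R (x + 1)) \<le> (1 - s) * (ln \<circ> Gamma) x + s * (ln \<circ> Gamma) (x + 1)"
    using assms by (intro convex_onD[OF log_convex_Gamma_real]) auto
  moreover have "(1 - s) *\<^sub>R x + s *\<^sub>R (x + 1) = x + s"
    by (simp add: algebra_simps)
  moreover have "Gamma (x + 1) = x * Gamma x"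
    using assms by (intro Gamma_plus1) (auto elim!: nonpos_Ints_cases)
  moreover have pos: "Gamma x > 0" "Gamma (x + s) > 0"
    using assms by simp_all
  moreover have "ln (x * Gamma x) = ln x + ln (Gamma x)"
    "ln (x powr s * Gamma x) = s * ln x + ln (Gamma x)"
    using assms less_imp_neq[OF pos(1)] by (simp_all add: ln_mult)
  ultimately have "ln (Gamma (x + s)) \<le> ln (x powr s * Gamma x)"
    by (simp add: algebra_simps)
  thus ?thesis
    using assms pos by (subst (asm) ln_le_cancel_iff) auto
qed

text \<open>The minimum of Gamma on the positive axis lies near 1.46, just left of 3/2.\<close>

lemma Gamma_real_mono_ge_three_halves:
  "3/2 \<le> x \<Longrightarrow> x \<le> y \<Longrightarrow> Gamma (x :: real) \<le> Gamma y"
  using Gamma_real_strict_mono[of x y] by (cases "x = y") auto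

text \<open>Gamma is not monotone near 1/2, so the comparison is made one unit to the right; the
  division by \<open>x\<close> \<ge> 1/2 costs the factor 2.\<close>

lemma Gamma_real_le_two_mult:
  fixes x y :: real
  assumes "x \<ge> 1/2" "x + 1 \<le> y"
  shows "Gamma x \<le> 2 * Gamma y"
proof -
  have "Gamma (x + 1) = x * Gamma x"
    using assms by (intro Gamma_plus1) (auto elim!: nonpos_Ints_cases)
  moreover have "1/2 * Gamma x \<le> x * Gamma x"
    using assms by (intro mult_right_mono) auto
  moreover have "Gamma (x + 1) \<le> Gamma y"
    using assms by (intro Gamma_real_mono_ge_three_halves) auto
  ultimately show ?thesis by simp
qed

section \<open>Growth of the reciprocal Gamma function\<close>

lemma norm_rGamma_le_left:
  fixes w :: complex
  assumes "Re w \<le> 1/2" "X \<ge> 2 - Re w"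
  shows "norm (rGamma w) \<le> Gamma X * exp (pi * \<bar>Im w\<bar>)"
proof -
  have "rGamma (1 - w) \<noteq> 0"
    using assms nonpos_Ints_subset_nonpos_Reals[where 'a = complex]
    by (force simp: rGamma_eq_zero_iff complex_nonpos_Reals_iff)
  hence "rGamma w = Gamma (1 - w) * sin (of_real pi * w) / of_real pi"
    using rGamma_reflection_complex[of w] by (simp add: Gamma_def field_simps)
  hence "norm (rGamma w) = norm (Gamma (1 - w)) * norm (sin (of_real pi * w)) / pi"
    by (simp add: norm_mult norm_divide)
  also have "\<dots> \<le> (2 * Gamma X) * exp (pi * \<bar>Im w\<bar>) / pi"
  proof (intro divide_right_mono mult_mono)
    have "norm (Gamma (1 - w)) \<le> Gamma (1 - Re w)"
      using assms norm_Gamma_complex_le[of "1 - w"] by simp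
    also have "\<dots> \<le> 2 * Gamma X"
      using assms by (intro Gamma_real_le_two_mult) auto
    finally show "norm (Gamma (1 - w)) \<le> 2 * Gamma X" .
    have "Re (complex_of_real pi * w) = pi * Re w" "Im (complex_of_real pi * w) = pi * Im w" by simp_all
    thus "norm (sin (of_real pi * w)) \<le> exp (pi * \<bar>Im w\<bar>)"
      using cmod_sin_le_exp[of 1 "of_real pi * w"] by (simp add: abs_mult)
  qed (use assms in auto)
  \<comment> \<open>The 2 from comparing Gamma values is absorbed by the 1/pi of the reflection
    formula.\<close>
  also have "\<dots> = (2 / pi) * (Gamma X * exp (pi * \<bar>Im w\<bar>))"
    by simp
  also have "\<dots> \<le> 1 * (Gamma X * exp (pi * \<bar>Im w\<bar>))"
    using assms pi_ge_two by (intro mult_right_mono) auto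
  finally show ?thesis by simp
qed

text \<open>Induction over strips of growing width:
  \<open>rGamma w = rGamma (w - 1) / (w - 1)\<close> carries the bound one unit to the right
  wherever \<open>norm (w - 1)\<close> \<ge> 1, and compactness handles a box around 1.\<close>

lemma norm_rGamma_le_right:
  "\<exists>C>0. \<forall>w::complex. Re w \<ge> -1/2 \<longrightarrow> norm (rGamma w) \<le> C * exp (pi * \<bar>Im w\<bar>)"
proof -
  let ?B = "cbox (Complex (-1/2) (-1)) (Complex 2 1)"
  have "bounded (rGamma ` ?B)"
    by (intro compact_imp_bounded compact_continuous_image continuous_intros) auto
  then obtain K where K: "\<And>w. w \<in> ?B \<Longrightarrow> norm (rGamma w) \<le> K"
    by (auto simp: bounded_iff)
  \<comment> \<open>\<open>Gamma (5/2)\<close> serves the strip -1/2 \<le> \<open>Re w\<close> \<le>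
    1/2, where \<open>2 - Re w\<close> is at most 5/2.\<close>
  define C where "C = max K (Gamma (5/2))"
  have "C > 0" by (simp add: C_def less_max_iff_disj)
  have "norm (rGamma w) \<le> C * exp (pi * \<bar>Im w\<bar>)"
    if "Re w \<ge> -1/2" "Re w \<le> real n + 1/2" for n w
    using that
  proof (induction n arbitrary: w)
    case 0
    hence "norm (rGamma w) \<le> Gamma (5/2) * exp (pi * \<bar>Im w\<bar>)"
      by (intro norm_rGamma_le_left) auto
    also have "\<dots> \<le> C * exp (pi * \<bar>Im w\<bar>)"
      by (intro mult_right_mono) (auto simp: C_def)
    finally show ?case .
  next
    case (Suc n)
    consider "w \<in> ?B" | "Re w \<le> 1/2" | "w \<notin> ?B" "Re w > 1/2"
      by linarith
    thus ?case
    proof cases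
      case 1
      have "norm (rGamma w) \<le> C * 1"
        using K[OF 1] by (simp add: C_def)
      also have "\<dots> \<le> C * exp (pi * \<bar>Im w\<bar>)"
        using \<open>C > 0\<close> by (intro mult_left_mono) auto
      finally show ?thesis .
    next
      case 2
      hence "norm (rGamma w) \<le> Gamma (5/2) * exp (pi * \<bar>Im w\<bar>)"
        using Suc.prems by (intro norm_rGamma_le_left) auto
      also have "\<dots> \<le> C * exp (pi * \<bar>Im w\<bar>)"
        by (intro mult_right_mono) (auto simp: C_def)
      finally show ?thesis .
    next
      case 3
      have "1 \<le> \<bar>Re (w - 1)\<bar> \<or> 1 \<le> \<bar>Im (w - 1)\<bar>"
        \<comment> \<open>Right of \<open>Re w = 1/2\<close>, the box is all that dividing by \<open>w - 1\<close> could spoil.\<close>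
        using 3 by (auto simp: in_cbox_complex_iff)
      hence "1 \<le> norm (w - 1)"
        using abs_Re_le_cmod[of "w - 1"] abs_Im_le_cmod[of "w - 1"] by linarith
      hence "1 * norm (rGamma w) \<le> norm (w - 1) * norm (rGamma w)"
        by (intro mult_right_mono) auto
      also have "\<dots> = norm (rGamma (w - 1))"
        using rGamma_plus1[of "w - 1"] by (simp flip: norm_mult)
      \<comment> \<open>\<open>Re w\<close> > 1/2 keeps \<open>w - 1\<close> in the half-plane, and
        the shift leaves the imaginary part alone, so \<open>C\<close> does not grow with
        \<open>n\<close>.\<close>
      also have "\<dots> \<le> C * exp (pi * \<bar>Im (w - 1)\<bar>)"
        using Suc.prems 3 by (intro Suc.IH) auto
      finally show ?thesis by simp
    qed
  qed
  hence "norm (rGamma w) \<le> C * exp (pi * \<bar>Im w\<bar>)" if "Re w \<ge> -1/2" for w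
    using that real_arch_simple[of "Re w - 1/2"] by (metis diff_le_eq)
  thus ?thesis using \<open>C > 0\<close> by blast
qed

text \<open>Merges both half-planes. Since \<open>X\<close> is only bounded below, one
  \<open>X\<close> can serve all parameters in a ball. The right-hand bound fits because
  \<open>Gamma X\<close> \<ge> \<open>Gamma (3/2)\<close>.\<close>

lemma norm_rGamma_le:
  "\<exists>C>0. \<forall>(w::complex) X. X \<ge> 3/2 \<longrightarrow> X \<ge> 2 - Re w \<longrightarrow>
     norm (rGamma w) \<le> C * Gamma X * exp (pi * \<bar>Im w\<bar>)"
proof -
  obtain C where C: "C > 0" "\<And>w::complex. Re w \<ge> -1/2 \<Longrightarrow> norm (rGamma w) \<le> C * exp (pi * \<bar>Im w\<bar>)"
    using norm_rGamma_le_right by blast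
  define G where "G = Gamma (3/2 :: real)"
  have "G > 0" by (simp add: G_def)
  define C' where "C' = max 1 (C / G)"
  have "norm (rGamma w) \<le> C' * Gamma X * exp (pi * \<bar>Im w\<bar>)"
    if X: "X \<ge> 3/2" "X \<ge> 2 - Re w" for X and w :: complex
  proof (cases "Re w \<le> 1/2")
    case True
    have "norm (rGamma w) \<le> 1 * (Gamma X * exp (pi * \<bar>Im w\<bar>))"
      using norm_rGamma_le_left[OF True X(2)] by simp
    also have "\<dots> \<le> C' * (Gamma X * exp (pi * \<bar>Im w\<bar>))"
      using X by (intro mult_right_mono) (auto simp: C'_def)
    finally show ?thesis by (simp add: mult.assoc)
  next
    case False
    have "G \<le> Gamma X"
      unfolding G_def using X by (intro Gamma_real_mono_ge_three_halves) auto
    hence "C / G * G \<le> C' * Gamma X"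
      using \<open>G > 0\<close> \<open>C > 0\<close> by (intro mult_mono) (auto simp: C'_def)
    hence "C \<le> C' * Gamma X" using \<open>G > 0\<close> by simp
    have "norm (rGamma w) \<le> C * exp (pi * \<bar>Im w\<bar>)"
      using False by (intro C) auto
    also have "\<dots> \<le> C' * Gamma X * exp (pi * \<bar>Im w\<bar>)"
      using \<open>C \<le> C' * Gamma X\<close> by (intro mult_right_mono) auto
    finally show ?thesis .
  qed
  moreover have "C' > 0" by (simp add: C'_def)
  ultimately show ?thesis by blast
qed

section \<open>A summable majorant, locally uniform in the parameters\<close>

lemma summable_power_Gamma_over_fact:
  fixes A s b :: real
  assumes "0 < s" "s < 1" "b > 0" "A \<ge> 0"
  shows "summable (\<lambda>k. A ^ k / fact k * Gamma (s * real k + b))"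
proof -
  \<comment> \<open>This expression bounds the quotient of consecutive terms.\<close>
  have "((\<lambda>k. A * (s * real k + b) powr s / real (Suc k)) \<longlongrightarrow> 0) sequentially"
    using assms by real_asymp
  hence "eventually (\<lambda>k. A * (s * real k + b) powr s / real (Suc k) < 1/2) sequentially"
    by (rule order_tendstoD) auto
  then obtain N where N: "\<And>k. k \<ge> N \<Longrightarrow> A * (s * real k + b) powr s / real (Suc k) < 1/2"
    by (auto simp: eventually_at_top_linorder)
  show ?thesis
  proof (rule summable_ratio_test[of "1/2" N])
    fix k assume "k \<ge> N"
    have pos: "s * real k + b > 0" using assms by (simp add: add_nonneg_pos)
    have "A ^ Suc k / fact (Suc k) * Gamma (s * real (Suc k) + b)
            = A ^ k / fact k * (A / real (Suc k)) * Gamma ((s * real k + b) + s)"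
      by (simp add: algebra_simps)
    also have "\<dots> \<le> A ^ k / fact k * (A / real (Suc k)) * ((s * real k + b) powr s * Gamma (s * real k + b))"
      using assms pos by (intro mult_left_mono Gamma_add_le_powr_mult) auto
    also have "\<dots> = (A * (s * real k + b) powr s / real (Suc k)) * (A ^ k / fact k * Gamma (s * real k + b))"
      by (simp add: mult_ac)
    also have "\<dots> \<le> 1/2 * (A ^ k / fact k * Gamma (s * real k + b))"
      using N[OF \<open>k \<ge> N\<close>] assms pos by (intro mult_right_mono) auto
    finally have "A ^ Suc k / fact (Suc k) * Gamma (s * real (Suc k) + b)
                    \<le> 1/2 * (A ^ k / fact k * Gamma (s * real k + b))" .
    moreover have "0 \<le> A ^ Suc k / fact (Suc k) * Gamma (s * real (Suc k) + b)"
      "0 \<le> A ^ k / fact k * Gamma (s * real k + b)"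
      using assms pos by (auto intro!: mult_nonneg_nonneg Gamma_real_nonneg divide_nonneg_pos add_nonneg_pos simp del: power_Suc fact_Suc of_nat_Suc)
    ultimately show "norm (A ^ Suc k / fact (Suc k) * Gamma (s * real (Suc k) + b))
                    \<le> 1/2 * norm (A ^ k / fact k * Gamma (s * real k + b))"
      by (simp only: real_norm_def abs_of_nonneg)
  qed simp
qed

lemma Wright_term_majorant:
  fixes \<alpha> \<beta> z :: complex
  assumes "Re \<alpha> > -1"
  obtains d h where "d > 0" "summable h" "\<And>(k::nat) a b. a \<in> ball \<alpha> d \<Longrightarrow> b \<in> ball \<beta> d \<Longrightarrow>
       norm (z ^ k / fact k * rGamma (a * of_nat k + b)) \<le> h k"
proof -
  obtain C where C: "C > 0" "\<And>(w::complex) X. X \<ge> 3/2 \<Longrightarrow> X \<ge> 2 - Re w \<Longrightarrow>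
     norm (rGamma w) \<le> C * Gamma X * exp (pi * \<bar>Im w\<bar>)"
    using norm_rGamma_le by blast
  \<comment> \<open>\<open>d\<close> stops halfway to the line \<open>Re a = -1\<close>, so
    \<open>- Re a\<close> < (1 - \<open>Re \<alpha>\<close>)/2 < 1 on the ball; the 1/2 in
    \<open>s\<close> keeps it positive for large \<open>Re \<alpha>\<close>.\<close>
  define d where "d = min 1 ((1 + Re \<alpha>) / 2)"
  define s where "s = max (1/2) ((1 - Re \<alpha>) / 2)"
  \<comment> \<open>\<open>norm \<beta> + 1\<close> bounds \<open>- Re b\<close>, and 2 more gives
    \<open>s * k + c\<close> \<ge> \<open>2 - Re (a * k + b)\<close>. \<open>A\<close> collects all
    k-th powers, including the growth in \<open>Im a\<close>.\<close>
  define c where "c = norm \<beta> + 3"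
  define A where "A = norm z * exp (pi * (norm \<alpha> + 1))"
  define h where "h k = C * exp (pi * (norm \<beta> + 1)) * (A ^ k / fact k * Gamma (s * real k + c))" for k
  have d: "d > 0" "d \<le> 1" "d \<le> (1 + Re \<alpha>) / 2"
    using assms unfolding d_def by (simp_all only: min_less_iff_conj min.cobounded1 min.cobounded2) simp
  have s: "0 < s" "s < 1" "s \<ge> (1 - Re \<alpha>) / 2"
    using assms unfolding s_def by (simp_all only: max_less_iff_conj less_max_iff_disj max.cobounded2) simp_all
  have c: "c \<ge> 3" by (simp add: c_def)
  have pos: "s * real k + c > 0" for k using s c by (simp add: add_nonneg_pos)
  show ?thesis
  proof (rule that[of d h])
    show "summable h"
      unfolding h_def using s c
      by (intro summable_mult summable_power_Gamma_over_fact) (auto simp: A_def)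
    fix k :: nat and a b :: complex
    assume a: "a \<in> ball \<alpha> d" and b: "b \<in> ball \<beta> d"
    let ?w = "a * of_nat k + b"
    have a': "norm (a - \<alpha>) < d" and b': "norm (b - \<beta>) < d"
      using a b by (auto simp: dist_norm norm_minus_commute)
    have "- Re a \<le> s"
      using abs_Re_le_cmod[of "a - \<alpha>"] a' d s by (simp add: field_simps)
    hence "- Re a * real k \<le> s * real k" by (intro mult_right_mono) auto
    moreover have "- Re b \<le> norm \<beta> + 1"
      using abs_Re_le_cmod[of b] norm_triangle_ineq2[of b \<beta>] b' d by linarith
    ultimately have X: "s * real k + c \<ge> 2 - Re ?w" by (simp add: c_def)
    have X': "s * real k + c \<ge> 3/2" using c s by (simp add: add_increasing)
    have "\<bar>Im ?w\<bar> \<le> \<bar>Im a\<bar> * real k + \<bar>Im b\<bar>"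
      using abs_triangle_ineq[of "Im a * real k" "Im b"] by (simp add: abs_mult)
    also have "\<dots> \<le> (norm \<alpha> + 1) * real k + (norm \<beta> + 1)"
    proof (intro add_mono mult_right_mono)
      show "\<bar>Im a\<bar> \<le> norm \<alpha> + 1"
        using abs_Im_le_cmod[of a] norm_triangle_ineq2[of a \<alpha>] a' d by linarith
      show "\<bar>Im b\<bar> \<le> norm \<beta> + 1"
        using abs_Im_le_cmod[of b] norm_triangle_ineq2[of b \<beta>] b' d by linarith
    qed auto
    finally have "exp (pi * \<bar>Im ?w\<bar>) \<le> exp (pi * ((norm \<alpha> + 1) * real k + (norm \<beta> + 1)))"
      by simp
    also have "\<dots> = exp (pi * (norm \<beta> + 1)) * exp (pi * (norm \<alpha> + 1)) ^ k"
      by (simp add: exp_of_nat_mult[symmetric] exp_add[symmetric] algebra_simps)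
    finally have E: "exp (pi * \<bar>Im ?w\<bar>) \<le> exp (pi * (norm \<beta> + 1)) * exp (pi * (norm \<alpha> + 1)) ^ k" .
    have "norm (z ^ k / fact k * rGamma ?w) = norm z ^ k / fact k * norm (rGamma ?w)"
      by (simp add: norm_mult norm_divide norm_power)
    also have "\<dots> \<le> norm z ^ k / fact k * (C * Gamma (s * real k + c) * exp (pi * \<bar>Im ?w\<bar>))"
      by (intro mult_left_mono C X X') auto
    also have "\<dots> \<le> norm z ^ k / fact k * (C * Gamma (s * real k + c) *
                 (exp (pi * (norm \<beta> + 1)) * exp (pi * (norm \<alpha> + 1)) ^ k))"
      using C(1) pos[of k] by (intro mult_left_mono E) auto
    also have "\<dots> = h k"
      by (simp add: h_def A_def power_mult_distrib)
    finally show "norm (z ^ k / fact k * rGamma ?w) \<le> h k" .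
  qed (use d in auto)
qed


section \<open>Termwise differentiation in each parameter\<close>

theorem corollary2p2:
  fixes \<alpha> \<beta> z :: complex
  assumes "Re \<alpha> > -1"
  shows "summable (\<lambda>k. z ^ k / fact k * rGamma (\<alpha> * of_nat k + \<beta>)) \<and>
     summable (\<lambda>k. of_nat (Suc k) / fact (Suc k)
           * Digamma_over_Gamma (\<alpha> * of_nat (Suc k) + \<beta>) * z ^ Suc k) \<and>
     ((\<lambda>a. Wright a \<beta> z) has_field_derivative
           - (\<Sum>k. of_nat (Suc k) / fact (Suc k)
                * Digamma_over_Gamma (\<alpha> * of_nat (Suc k) + \<beta>) * z ^ Suc k)) (at \<alpha>) \<and>
     summable (\<lambda>k. 1 / fact k * Digamma_over_Gamma (\<alpha> * of_nat k + \<beta>) * z ^ k) \<and>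
     ((\<lambda>b. Wright \<alpha> b z) has_field_derivative
           - (\<Sum>k. 1 / fact k * Digamma_over_Gamma (\<alpha> * of_nat k + \<beta>) * z ^ k)) (at \<beta>)"
proof -
  define f where "f = (\<lambda>k a b. z ^ k / fact k * rGamma (a * of_nat k + b))"
  define g where "g = (\<lambda>k a b. 1 / fact k * Digamma_over_Gamma (a * of_nat k + b) * z ^ k)"
  \<comment> \<open>This holds at the poles of Gamma too, so no case split is needed when an
    argument is a nonpositive integer.\<close>
  have deriv: "(rGamma has_field_derivative - Digamma_over_Gamma w) (at w)" for w
    using field_differentiable_rGamma[of w UNIV]
    by (simp add: Digamma_over_Gamma_eq_deriv_rGamma field_differentiable_derivI)
  have Wright_sums: "Wright a b z = v" if "(\<lambda>k. f k a b) sums v" for a b v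
    using sums_unique[OF that] by (simp add: Wright_def f_def)
  define S where "S = {a. Re a > -1}"
  have S: "open S" "\<alpha> \<in> S"
    using assms by (auto simp: S_def open_halfspace_Re_gt)

  have "\<exists>u u'. \<forall>a\<in>S. ((\<lambda>k. f k a \<beta>) sums u a) \<and> ((\<lambda>k. - (of_nat k * g k a \<beta>)) sums u' a) \<and>
          (u has_field_derivative u' a) (at a)"
  \<comment> \<open>Only the terms themselves need a majorant; for holomorphic terms the convergence
    of the derived series follows.\<close>
  proof (rule series_and_derivative_comparison_local[OF S(1)])
    fix k a
    show "((\<lambda>a. f k a \<beta>) has_field_derivative - (of_nat k * g k a \<beta>)) (at a)"
    proof -
      have "((\<lambda>a. a * of_nat k + \<beta>) has_field_derivative of_nat k) (at a)"
        by (auto intro!: derivative_eq_intros)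
      from DERIV_cmult[OF DERIV_chain2[OF deriv this], of "z ^ k / fact k"] show ?thesis
        by (simp add: f_def g_def mult_ac)
    qed
  next
    fix a assume "a \<in> S"
    then obtain d h where "d > 0" "summable h"
      "\<And>k a' b. a' \<in> ball a d \<Longrightarrow> b \<in> ball \<beta> d \<Longrightarrow> norm (f k a' b) \<le> h k"
      unfolding f_def S_def using Wright_term_majorant[where z = z and \<beta> = \<beta>] by (metis mem_Collect_eq)
    thus "\<exists>d h. 0 < d \<and> summable h \<and>
            (\<forall>\<^sub>F k in sequentially. \<forall>y\<in>ball a d \<inter> S. norm (f k y \<beta>) \<le> h k)"
      by (intro exI[of _ d] exI[of _ h]) auto
  qed
  then obtain u u' where u: "\<And>a. a \<in> S \<Longrightarrow> (\<lambda>k. f k a \<beta>) sums u a"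
    "\<And>a. a \<in> S \<Longrightarrow> (\<lambda>k. - (of_nat k * g k a \<beta>)) sums u' a"
    "\<And>a. a \<in> S \<Longrightarrow> (u has_field_derivative u' a) (at a)"
    by blast
  \<comment> \<open>\<open>u\<close> is known to agree with \<open>Wright\<close> only on
    \<open>S\<close>; openness of \<open>S\<close> transfers the derivative.\<close>
  have W\<alpha>: "((\<lambda>a. Wright a \<beta> z) has_field_derivative u' \<alpha>) (at \<alpha>)"
    by (rule has_field_derivative_transform_within_open[OF u(3)[OF S(2)] S])
       (use Wright_sums[OF u(1)] in simp)
  have "(\<lambda>k. of_nat k * g k \<alpha> \<beta>) sums - u' \<alpha>"
    using sums_minus[OF u(2)[OF S(2)]] by simp
  \<comment> \<open>The term for k = 0 vanishes through its factor k, so the sum may start at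
    1.\<close>
  hence "(\<lambda>k. of_nat (Suc k) * g (Suc k) \<alpha> \<beta>) sums - u' \<alpha>"
    using sums_Suc_iff[of "\<lambda>k. of_nat k * g k \<alpha> \<beta>" "- u' \<alpha>"] by simp
  hence sums\<alpha>: "(\<lambda>k. of_nat (Suc k) / fact (Suc k)
           * Digamma_over_Gamma (\<alpha> * of_nat (Suc k) + \<beta>) * z ^ Suc k) sums - u' \<alpha>"
    by (simp add: g_def mult.assoc del: fact_Suc of_nat_Suc power_Suc)

  have "\<exists>v v'. \<forall>b\<in>UNIV. ((\<lambda>k. f k \<alpha> b) sums v b) \<and> ((\<lambda>k. - g k \<alpha> b) sums v' b) \<and>
          (v has_field_derivative v' b) (at b)"
  proof (rule series_and_derivative_comparison_local[OF open_UNIV])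
    fix k b
    show "((\<lambda>b. f k \<alpha> b) has_field_derivative - g k \<alpha> b) (at b)"
    proof -
      have "((\<lambda>b. \<alpha> * of_nat k + b) has_field_derivative 1) (at b)"
        by (auto intro!: derivative_eq_intros)
      from DERIV_cmult[OF DERIV_chain2[OF deriv this], of "z ^ k / fact k"] show ?thesis
        by (simp add: f_def g_def mult_ac)
    qed
  next
    fix b
    obtain d h where "d > 0" "summable h"
      "\<And>k a b'. a \<in> ball \<alpha> d \<Longrightarrow> b' \<in> ball b d \<Longrightarrow> norm (f k a b') \<le> h k"
      unfolding f_def using Wright_term_majorant[OF assms, where z = z and \<beta> = b] by metis
    thus "\<exists>d h. 0 < d \<and> summable h \<and>
            (\<forall>\<^sub>F k in sequentially. \<forall>y\<in>ball b d \<inter> UNIV. norm (f k \<alpha> y) \<le> h k)"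
      by (intro exI[of _ d] exI[of _ h]) auto
  qed
  then obtain v v' where v: "\<And>b. (\<lambda>k. f k \<alpha> b) sums v b"
    "\<And>b. (\<lambda>k. - g k \<alpha> b) sums v' b" "\<And>b. (v has_field_derivative v' b) (at b)"
    by blast
  have "(\<lambda>b. Wright \<alpha> b z) = v"
    using Wright_sums[OF v(1)] by auto
  hence W\<beta>: "((\<lambda>b. Wright \<alpha> b z) has_field_derivative v' \<beta>) (at \<beta>)"
    using v(3) by simp
  have sums\<beta>: "(\<lambda>k. 1 / fact k * Digamma_over_Gamma (\<alpha> * of_nat k + \<beta>) * z ^ k) sums - v' \<beta>"
    using sums_minus[OF v(2)[of \<beta>]] by (simp add: g_def)

  have "summable (\<lambda>k. z ^ k / fact k * rGamma (\<alpha> * of_nat k + \<beta>))"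
    using sums_summable[OF v(1)[of \<beta>]] by (simp add: f_def)
  thus ?thesis
    using W\<alpha> W\<beta> sums_summable[OF sums\<alpha>] sums_summable[OF sums\<beta>]
    by (simp only: sums_unique[OF sums\<alpha>, symmetric] sums_unique[OF sums\<beta>, symmetric] minus_minus simp_thms)
qed

end
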